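(* Let $q\in(0,1)$, $W^\ast\in\mathbb{R}^{m\times d}$, and let $X=[x_1,\dots,x_N]\in\mathbb{R}^{d\times N}$ have full row rank. Assume $y_i=W^\ast x_i$ for $i=1,\dots,N$, and define $\Phi:\mathbb{R}^{m\times d}\to\mathbb{R}$ by $$\Phi(W):=\left(\frac{1}{N}\sum_{i=1}^N\|Wx_i-y_i\|_2\right)^q.$$ Fix $R>0$ and let $K_R:=\{W\in\mathbb{R}^{m\times d}:\|W-W^\ast\|_F\le R\}$. Then, for every $\kappa\in(0,q)$, the function $\Phi$ is $(\kappa,\gamma)$-strongly quasar-convex on $K_R$ with respect to $W^\ast$, where $$\gamma=\frac{2(q-\kappa)}{\kappa}\,c_X^q\,R^{q-2},\qquad c_X:=\min_{\|U\|_F=1}\frac{1}{N}\sum_{i=1}^N\|Ux_i\|_2>0.$$ Moreover, $\Phi$ is neither convex nor strongly star-convex.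
   Context: $\|\cdot\|_2$ is the Euclidean norm on $\mathbb{R}^m$; $\mathbb{R}^{m\times d}$ is identified with $\mathbb{R}^{md}$ with the Frobenius norm $\|\cdot\|_F$; the minimum defining $c_X$ is over $U\in\mathbb{R}^{m\times d}$. For $\kappa\in(0,1]$, $\gamma\ge 0$, a function $\Phi$ is $(\kappa,\gamma)$-strongly quasar-convex on a convex set $K$ with respect to a minimizer $W^\ast\in K$ of $\Phi$ if for all $W\in K$ and all $\lambda\in[0,1]$, $$\Phi(\lambda W^\ast+(1-\lambda)W)\le\kappa\lambda\Phi(W^\ast)+(1-\kappa\lambda)\Phi(W)-\lambda\left(1-\frac{\lambda}{2-\kappa}\right)\frac{\kappa\gamma}{2}\|W-W^\ast\|_F^2.$$ $\Phi$ is strongly star-convex with respect to $W^\ast$ if this inequality holds with $\kappa=1$ and some $\gamma>0$ (for all $W$). *)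

theory Defs
  imports "HOL-Analysis.Analysis"
begin

text \<open>Matrices in $R^{m \times d}$ have type \<open>real^'d^'m\<close>; the library norm on this type is the
  Frobenius norm, as the following lemma makes explicit.\<close>

lemma norm_matrix_eq_frobenius:
  fixes W :: "real^'d^'m"
  shows "norm W = sqrt (\<Sum>i\<in>UNIV. \<Sum>j\<in>UNIV. (W $ i $ j)\<^sup>2)"
  by (simp add: norm_vec_def L2_set_def sum_nonneg)

text \<open>The base point is required to minimize \<open>\<Phi>\<close> over the whole space, not only over \<open>K\<close>.\<close>

definition strongly_quasar_convex_on ::
  "'a::real_normed_vector set \<Rightarrow> ('a \<Rightarrow> real) \<Rightarrow> 'a \<Rightarrow> real \<Rightarrow> real \<Rightarrow> bool"
  where "strongly_quasar_convex_on K \<Phi> Wstar \<kappa> \<gamma> \<longleftrightarrow>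
    0 < \<kappa> \<and> \<kappa> \<le> 1 \<and> 0 \<le> \<gamma> \<and>
    convex K \<and> Wstar \<in> K \<and> (\<forall>W. \<Phi> Wstar \<le> \<Phi> W) \<and>
    (\<forall>W\<in>K. \<forall>t\<in>{0..1}.
       \<Phi> (t *\<^sub>R Wstar + (1 - t) *\<^sub>R W)
         \<le> \<kappa> * t * \<Phi> Wstar + (1 - \<kappa> * t) * \<Phi> W
           - t * (1 - t / (2 - \<kappa>)) * (\<kappa> * \<gamma> / 2) * (norm (W - Wstar))\<^sup>2)"

definition strongly_star_convex_on ::
  "'a::real_normed_vector set \<Rightarrow> ('a \<Rightarrow> real) \<Rightarrow> 'a \<Rightarrow> bool"
  where "strongly_star_convex_on K \<Phi> Wstar \<longleftrightarrow>
    (\<exists>\<gamma>>0. strongly_quasar_convex_on K \<Phi> Wstar 1 \<gamma>)"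

end

theory Submission imports Defs begin

text \<open>
  The function \<open>p U = 1/N * (\<Sum>i. norm (U x\<^sub>i))\<close> is a norm on matrices: it vanishes only at \<open>0\<close>
  because the columns of a matrix of full row rank span the whole space. Since \<open>y\<^sub>i = Wstar x\<^sub>i\<close>,
  \<open>\<Phi> W = p (W - Wstar) powr q\<close>, so that \<open>\<Phi>\<close> vanishes at its minimizer \<open>Wstar\<close> and on every ray
  leaving \<open>Wstar\<close> it is a multiple of \<open>s powr q\<close>. Everything follows from this.

  The continuous function \<open>p\<close> attains a positive minimum \<open>c\<close> on the compact unit sphere, hence
  \<open>p U \<ge> c * norm U\<close>. For strong quasar-convexity, put \<open>U = W - Wstar\<close> and \<open>a = p U powr q\<close>. The value
  at the intermediate point is \<open>(1 - t) powr q * a\<close>, which is at most \<open>(1 - q * t) * a\<close> by Bernoulli's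
  inequality. Passing from \<open>q\<close> to \<open>\<kappa> < q\<close> leaves the surplus \<open>(q - \<kappa>) * t * a\<close>, and this pays for the
  quadratic term because \<open>norm U \<le> R\<close> and \<open>q < 2\<close> give
  \<open>a \<ge> c powr q * norm U powr q \<ge> c powr q * R powr (q - 2) * (norm U)\<^sup>2\<close>.

  Both negative claims come from the midpoint of a segment starting at \<open>Wstar\<close>: there \<open>\<Phi>\<close> has the value
  \<open>(1/2) powr q * a\<close>, which exceeds \<open>a / 2\<close>, whereas either convexity or strong star-convexity
  would bound it by \<open>a / 2\<close>.

  Only continuity, positive homogeneity and positivity of \<open>p\<close> away from \<open>0\<close> are used, so the argument
  is carried out for such functions on a Euclidean space.
\<close>

text \<open>Bernoulli's inequality for exponents in \<open>[0, 1]\<close>, obtained from the weighted inequality of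
  arithmetic and geometric means for \<open>1 - t\<close> and \<open>1\<close> with weights \<open>q\<close> and \<open>1 - q\<close>.\<close>

lemma one_minus_powr_le:
  fixes q t :: real
  assumes "0 \<le> q" "q \<le> 1" "0 \<le> t" "t \<le> 1"
  shows "(1 - t) powr q \<le> 1 - q * t"
  \<comment> \<open>At \<open>t = 1\<close> the left-hand side is \<open>0 powr q = 0\<close>, also for \<open>q = 0\<close>.\<close>
proof (cases "t = 1")
  case True
  then show ?thesis
    using assms by simp
next
  case False
  have "(1 - t) powr q * 1 powr (1 - q) \<le> q * (1 - t) + (1 - q) * 1"
    by (rule Youngs_inequality_0) (use assms False in auto)
  then show ?thesis
    by (simp add: algebra_simps)
qed

lemma continuous_attains_INF_sphere:
  fixes p :: "'a::euclidean_space \<Rightarrow> real"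
  assumes "continuous_on UNIV p"
  obtains U where "norm U = 1" "(INF V\<in>{V. norm V = 1}. p V) = p U"
    "\<And>V. norm V = 1 \<Longrightarrow> p U \<le> p V"
proof -
  have S: "{V::'a. norm V = 1} = sphere 0 1"
    by auto
  have "compact {V::'a. norm V = 1}"
    unfolding S by simp
  moreover have "{V::'a. norm V = 1} \<noteq> {}"
    using vector_choose_size[of 1, where 'a='a] by auto
  moreover have "continuous_on {V::'a. norm V = 1} p"
    using assms continuous_on_subset by blast
  ultimately have "\<exists>U\<in>{V. norm V = 1}. \<forall>V\<in>{V. norm V = 1}. p U \<le> p V"
    by (rule continuous_attains_inf)
  then obtain U where U: "norm U = 1" "\<And>V. norm V = 1 \<Longrightarrow> p U \<le> p V"
    by blast
  then have "(INF V\<in>{V. norm V = 1}. p V) = p U"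
    by (intro cInf_eq_minimum) auto
  with U that show thesis
    by blast
qed

lemma homogeneous_lower_bound:
  fixes p :: "'a::real_normed_vector \<Rightarrow> real"
  assumes hom: "\<And>r U. 0 \<le> r \<Longrightarrow> p (r *\<^sub>R U) = r * p U"
    and c: "\<And>V. norm V = 1 \<Longrightarrow> c \<le> p V"
  shows "c * norm U \<le> p U"
proof (cases "U = 0")
  case True
  then show ?thesis
    using hom[of 0 U] by simp
next
  case False
  then have "c * norm U \<le> p (inverse (norm U) *\<^sub>R U) * norm U"
    by (intro mult_right_mono c) auto
  also have "\<dots> = p U"
    using False by (subst hom) (auto simp: field_simps)
  finally show ?thesis .
qed

text \<open>The quantitative positive part. Neither continuity nor the triangle inequality for \<open>p\<close>
  matters here, since the inequality only compares values of \<open>p\<close> along one ray.\<close>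

lemma homogeneous_powr_strongly_quasar_convex:
  fixes p :: "'a::real_normed_vector \<Rightarrow> real" and W0 :: 'a
  assumes hom: "\<And>r U. 0 \<le> r \<Longrightarrow> p (r *\<^sub>R U) = r * p U"
    and c: "0 < c" "\<And>U. c * norm U \<le> p U"
    and q: "q < 1" and \<kappa>: "0 < \<kappa>" "\<kappa> < q" and R: "0 < R"
  shows "strongly_quasar_convex_on {W. norm (W - W0) \<le> R} (\<lambda>W. p (W - W0) powr q) W0 \<kappa>
           (2 * (q - \<kappa>) / \<kappa> * c powr q * R powr (q - 2))"
proof -
  have nonneg: "0 \<le> p U" for U
    using c(1) c(2)[of U] by (meson less_imp_le mult_nonneg_nonneg norm_ge_zero order_trans)
  have p0: "p 0 = 0"
    using hom[of 0 0] by simp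
  have conv: "convex {W. norm (W - W0) \<le> R}"
  proof -
    have "{W. norm (W - W0) \<le> R} = cball W0 R"
      by (auto simp: dist_norm norm_minus_commute)
    then show ?thesis
      by simp
  qed
  have ineq: "p (t *\<^sub>R W0 + (1 - t) *\<^sub>R W - W0) powr q
      \<le> \<kappa> * t * p (W0 - W0) powr q + (1 - \<kappa> * t) * p (W - W0) powr q
        - t * (1 - t / (2 - \<kappa>)) * (\<kappa> * (2 * (q - \<kappa>) / \<kappa> * c powr q * R powr (q - 2)) / 2)
          * (norm (W - W0))\<^sup>2"
    if W: "norm (W - W0) \<le> R" and t: "0 \<le> t" "t \<le> 1" for W t
  proof -
    define U where "U = W - W0"
    define a where "a = p U powr q"
    define e where "e = c powr q * R powr (q - 2) * (norm U)\<^sup>2"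
    have e0: "0 \<le> e"
      by (simp add: e_def)
    \<comment> \<open>The exponent \<open>q - 2\<close> is negative, so \<open>norm U \<le> R\<close> gives \<open>R powr (q - 2) \<le> norm U powr (q - 2)\<close>.\<close>
    have "R powr (q - 2) * (norm U)\<^sup>2 \<le> norm U powr q"
    proof (cases "U = 0")
      case False
      then have "R powr (q - 2) * (norm U)\<^sup>2 \<le> norm U powr (q - 2) * (norm U)\<^sup>2"
        using W q by (intro mult_right_mono powr_mono2') (auto simp: U_def)
      also have "\<dots> = norm U powr (q - 2) * norm U powr 2"
        using False by simp
      also have "\<dots> = norm U powr q"
        by (simp only: powr_add[symmetric]) simp
      finally show ?thesis .
    qed simp
    then have "e \<le> c powr q * norm U powr q"
      unfolding e_def mult.assoc by (intro mult_left_mono) auto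
    also have "\<dots> = (c * norm U) powr q"
      using c(1) by (simp add: powr_mult)
    also have "\<dots> \<le> a"
      unfolding a_def using c \<kappa> by (intro powr_mono2) auto
    finally have ea: "e \<le> a" .
    \<comment> \<open>The term of order \<open>t\<^sup>2\<close> only weakens the required inequality and can be dropped.\<close>
    have "1 - t / (2 - \<kappa>) \<le> 1"
      using t \<kappa> q by simp
    then have "(1 - t / (2 - \<kappa>)) * e \<le> 1 * e"
      using e0 by (rule mult_right_mono)
    with ea have "(1 - t / (2 - \<kappa>)) * e \<le> a"
      by linarith
    then have quad: "t * (q - \<kappa>) * ((1 - t / (2 - \<kappa>)) * e) \<le> t * (q - \<kappa>) * a"
      using t \<kappa> by (intro mult_left_mono) auto
    have "t *\<^sub>R W0 + (1 - t) *\<^sub>R W - W0 = (1 - t) *\<^sub>R U"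
      by (simp add: U_def algebra_simps)
    then have "p (t *\<^sub>R W0 + (1 - t) *\<^sub>R W - W0) powr q = (1 - t) powr q * a"
      using t nonneg[of U] by (simp add: hom powr_mult a_def)
    also have "\<dots> \<le> (1 - q * t) * a"
      using t q \<kappa> by (intro mult_right_mono one_minus_powr_le) (auto simp: a_def)
    also have "\<dots> = (1 - \<kappa> * t) * a - t * (q - \<kappa>) * a"
      by (simp add: algebra_simps)
    also have "\<dots> \<le> (1 - \<kappa> * t) * a - t * (q - \<kappa>) * ((1 - t / (2 - \<kappa>)) * e)"
      using quad by simp
    also have "\<dots> = \<kappa> * t * p (W0 - W0) powr q + (1 - \<kappa> * t) * p (W - W0) powr q
        - t * (1 - t / (2 - \<kappa>)) * (\<kappa> * (2 * (q - \<kappa>) / \<kappa> * c powr q * R powr (q - 2)) / 2)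
          * (norm (W - W0))\<^sup>2"
      using \<kappa>(1) by (simp add: p0 a_def e_def U_def)
    finally show ?thesis .
  qed
  show ?thesis
    unfolding strongly_quasar_convex_on_def
    using conv ineq \<kappa> q R p0 by auto
qed

text \<open>Strict concavity of \<open>s powr q\<close> along a ray, at the midpoint; it rules out both convexity and
  strong star-convexity by the two lemmas that follow.\<close>

lemma homogeneous_powr_midpoint:
  fixes p :: "'a::real_normed_vector \<Rightarrow> real" and W0 W :: 'a
  assumes hom: "\<And>r U. 0 \<le> r \<Longrightarrow> p (r *\<^sub>R U) = r * p U"
    and pos: "0 < p (W - W0)" and q: "q < 1"
  shows "p (W0 - W0) powr q / 2 + p (W - W0) powr q / 2
    < p ((1/2) *\<^sub>R W0 + (1/2) *\<^sub>R W - W0) powr q"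
proof -
  have "(1/2) *\<^sub>R W0 + (1/2) *\<^sub>R W - W0 = (1/2) *\<^sub>R (W - W0)"
    by (simp add: scaleR_diff_right algebra_simps flip: scaleR_add_left)
  then have eq: "p ((1/2) *\<^sub>R W0 + (1/2) *\<^sub>R W - W0) powr q = (1/2) powr q * p (W - W0) powr q"
    using pos by (simp only: hom powr_mult)
  have "(1/2::real) powr 1 < (1/2) powr q"
    using q by (intro powr_less_mono') auto
  then have "1/2 * p (W - W0) powr q < (1/2) powr q * p (W - W0) powr q"
    using pos by (intro mult_strict_right_mono) auto
  moreover have "p (W0 - W0) = 0"
    using hom[of 0 0] by simp
  ultimately show ?thesis
    unfolding eq by simp
qed

lemma not_convex_on_midpoint:
  fixes \<Phi> :: "'a::real_vector \<Rightarrow> real"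
  assumes "W0 \<in> K" "W \<in> K"
    and "\<Phi> W0 / 2 + \<Phi> W / 2 < \<Phi> ((1/2) *\<^sub>R W0 + (1/2) *\<^sub>R W)"
  shows "\<not> convex_on K \<Phi>"
proof
  assume "convex_on K \<Phi>"
  then have "\<Phi> ((1 - 1/2) *\<^sub>R W0 + (1/2) *\<^sub>R W) \<le> (1 - 1/2) * \<Phi> W0 + (1/2) * \<Phi> W"
    using assms by (intro convex_onD) auto
  with assms(3) show False
    by simp
qed

lemma not_strongly_star_convex_on_midpoint:
  fixes \<Phi> :: "'a::real_normed_vector \<Rightarrow> real"
  assumes W: "W \<in> K"
    and mid: "\<Phi> W0 / 2 + \<Phi> W / 2 < \<Phi> ((1/2) *\<^sub>R W0 + (1/2) *\<^sub>R W)"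
  shows "\<not> strongly_star_convex_on K \<Phi> W0"
proof
  assume "strongly_star_convex_on K \<Phi> W0"
  then obtain \<gamma> where \<gamma>: "0 < \<gamma>"
    and ineq: "\<forall>W\<in>K. \<forall>t\<in>{0..1}.
       \<Phi> (t *\<^sub>R W0 + (1 - t) *\<^sub>R W)
         \<le> 1 * t * \<Phi> W0 + (1 - 1 * t) * \<Phi> W
           - t * (1 - t / (2 - 1)) * (1 * \<gamma> / 2) * (norm (W - W0))\<^sup>2"
    unfolding strongly_star_convex_on_def strongly_quasar_convex_on_def by blast
  have "\<Phi> ((1/2) *\<^sub>R W0 + (1 - 1/2) *\<^sub>R W)
         \<le> 1 * (1/2) * \<Phi> W0 + (1 - 1 * (1/2)) * \<Phi> W
           - (1/2) * (1 - (1/2) / (2 - 1)) * (1 * \<gamma> / 2) * (norm (W - W0))\<^sup>2"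
    using ineq W by (meson atLeastAtMost_iff half_bounded_equal zero_le_one order.refl
        zero_le_divide_1_iff zero_le_numeral divide_le_eq_1_pos one_le_numeral zero_less_numeral)
  moreover have "0 \<le> \<gamma> * (norm (W - W0))\<^sup>2"
    using \<gamma> by simp
  ultimately show False
    using mid by simp
qed

lemma full_row_rank_mult_columns_eq_0:
  fixes X :: "real^'N^'d" and U :: "real^'d^'m"
  assumes rank: "rank X = CARD('d)" and zero: "\<And>i. U *v column i X = 0"
  shows "U = 0"
proof -
  have UX: "U ** X = 0"
    using zero by (simp add: vec_eq_iff matrix_matrix_mult_def matrix_vector_mult_def column_def)
  have "U *v w = 0" for w
  proof -
    from rank have "surj ((*v) X)"
      by (simp add: full_rank_surjective)
    then obtain z where "w = X *v z"
      by (auto simp: surj_def)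
    then show ?thesis
      by (simp add: matrix_vector_mul_assoc UX)
  qed
  then show ?thesis
    by (simp add: matrix_eq)
qed

theorem proposition57:
  fixes q R c\<^sub>X :: real
    and Wstar :: "real^'d^'m"
    and X :: "real^'N^'d"
    and y :: "'N \<Rightarrow> real^'m"
    and \<Phi> :: "real^'d^'m \<Rightarrow> real"
    and K\<^sub>R :: "(real^'d^'m) set"
  assumes q: "0 < q" "q < 1"
    and full_row_rank: "rank X = CARD('d)"
    and y: "\<And>i. y i = Wstar *v column i X"
    and Phi: "\<And>W. \<Phi> W =
      (1 / real CARD('N) * (\<Sum>i\<in>UNIV. norm (W *v column i X - y i))) powr q"
    and R: "0 < R"
    and K: "K\<^sub>R = {W. norm (W - Wstar) \<le> R}"
    and c: "c\<^sub>X = (INF U\<in>{U :: real^'d^'m. norm U = 1}.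
      1 / real CARD('N) * (\<Sum>i\<in>UNIV. norm (U *v column i X)))"
  shows "(\<exists>U :: real^'d^'m. norm U = 1 \<and>
           c\<^sub>X = 1 / real CARD('N) * (\<Sum>i\<in>UNIV. norm (U *v column i X)))
    \<and> 0 < c\<^sub>X
    \<and> (\<forall>\<kappa>. 0 < \<kappa> \<and> \<kappa> < q \<longrightarrow>
         strongly_quasar_convex_on K\<^sub>R \<Phi> Wstar \<kappa>
           (2 * (q - \<kappa>) / \<kappa> * c\<^sub>X powr q * R powr (q - 2)))
    \<and> \<not> convex_on UNIV \<Phi> \<and> \<not> convex_on K\<^sub>R \<Phi>
    \<and> \<not> strongly_star_convex_on UNIV \<Phi> Wstar
    \<and> \<not> strongly_star_convex_on K\<^sub>R \<Phi> Wstar"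
proof -
  define p where "p U = 1 / real CARD('N) * (\<Sum>i\<in>UNIV. norm (U *v column i X))" for U :: "real^'d^'m"
  have hom: "p (r *\<^sub>R U) = r * p U" if "0 \<le> r" for r U
    using that by (simp add: p_def scaleR_matrix_vector_assoc[symmetric] sum_distrib_left mult_ac)
  have pos: "0 < p U" if "U \<noteq> 0" for U
  proof -
    have "\<exists>i. U *v column i X \<noteq> 0"
      using full_row_rank_mult_columns_eq_0[OF full_row_rank, of U] that by blast
    then obtain i where "0 < norm (U *v column i X)"
      by auto
    then have "0 < (\<Sum>i\<in>UNIV. norm (U *v column i X))"
      by (intro sum_pos2[of _ i]) auto
    then show ?thesis
      by (simp add: p_def)
  qed
  have cont: "continuous_on UNIV p"
    unfolding p_def matrix_vector_mult_def
    by (intro continuous_intros)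
  obtain U where U: "norm U = 1" "(INF V\<in>{V. norm V = 1}. p V) = p U"
    "\<And>V. norm V = 1 \<Longrightarrow> p U \<le> p V"
    using continuous_attains_INF_sphere[OF cont] by blast
  have cU: "c\<^sub>X = p U"
    using U(2) by (simp add: c p_def)
  have "U \<noteq> 0"
    using U(1) by auto
  then have c0: "0 < c\<^sub>X"
    using pos cU by simp
  have lower: "c\<^sub>X * norm V \<le> p V" for V
    using homogeneous_lower_bound[of p c\<^sub>X V] hom U(3) cU by simp
  have Phi_p: "\<Phi> = (\<lambda>W. p (W - Wstar) powr q)"
    by (rule ext) (simp add: Phi p_def y matrix_vector_mult_diff_rdistrib)
  have quasar: "strongly_quasar_convex_on K\<^sub>R \<Phi> Wstar \<kappa>
      (2 * (q - \<kappa>) / \<kappa> * c\<^sub>X powr q * R powr (q - 2))" if "0 < \<kappa>" "\<kappa> < q" for \<kappa>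
    unfolding K Phi_p
    using that q R c0 lower hom by (intro homogeneous_powr_strongly_quasar_convex) auto
  \<comment> \<open>A point at distance exactly \<open>R\<close>, so that the same segment works for the ball and for the whole space.\<close>
  define W where "W = Wstar + R *\<^sub>R U"
  have mem: "Wstar \<in> K\<^sub>R" "W \<in> K\<^sub>R"
    using R U(1) by (auto simp: K W_def)
  have "0 < p (W - Wstar)"
    using R \<open>U \<noteq> 0\<close> by (intro pos) (simp add: W_def)
  then have mid: "\<Phi> Wstar / 2 + \<Phi> W / 2 < \<Phi> ((1/2) *\<^sub>R Wstar + (1/2) *\<^sub>R W)"
    unfolding Phi_p using hom q by (intro homogeneous_powr_midpoint) auto
  show ?thesis
    using U(1) cU c0 quasar
      not_convex_on_midpoint[OF _ _ mid, of UNIV] not_convex_on_midpoint[OF mem mid]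
      not_strongly_star_convex_on_midpoint[OF _ mid, of UNIV]
      not_strongly_star_convex_on_midpoint[OF mem(2) mid]
    unfolding p_def by blast
qed

end
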